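(* Let $m\geq 1$ and assume that the child distributions $\chi$ and $\widetilde\chi$ have finite $m$th moments. Let $\Psi$ and $\widetilde\Psi$ be the automaton distribution maps of the recursive tree systems $(\chi,h)$ and $(\widetilde\chi,h)$, respectively. If $\chi(\ell)=\widetilde\chi(\ell)$ whenever $h(\ell)\leq m$, then $\Psi^{(m)}(0)=\widetilde\Psi^{(m)}(0)$.
   Context: A child distribution $\chi$ is a probability measure on $\mathbb{N}=\{0,1,2,\ldots\}$; write $\chi(n)=\chi(\{n\})$. A recursive tree system $(\chi,h)$ consists of a child distribution $\chi$ and a threshold function $h\colon\mathbb{N}\to\{1,2,3,\ldots\}$ (so $h(\ell)\geq 1$ for all $\ell\geq 0$). Its automaton distribution map is $\Psi\colon[0,1]\to[0,1]$, $\Psi(x)=\sum_{\ell=0}^\infty \chi(\ell)\,\mathbb{P}[\mathrm{Bin}(\ell,x)\geq h(\ell)]$, where $\mathrm{Bin}(\ell,x)$ is a binomial random variable. Derivatives at $0$ are one-sided. *)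

theory Defs
  imports "HOL-Probability.Probability"
begin

definition finite_moment :: "nat \<Rightarrow> nat pmf \<Rightarrow> bool" where
  "finite_moment m \<nu> \<longleftrightarrow> integrable (measure_pmf \<nu>) (\<lambda>l. real l ^ m)"

text \<open>
  The automaton distribution map has domain [0,1]; outside this interval
  \<^const>\<open>binomial_pmf\<close> is unspecified, so the values there carry no meaning.
\<close>

definition automaton_map :: "nat pmf \<Rightarrow> (nat \<Rightarrow> nat) \<Rightarrow> real \<Rightarrow> real" where
  "automaton_map \<nu> h x =
     (\<Sum>l. pmf \<nu> l * measure_pmf.prob (binomial_pmf l x) {k. h l \<le> k})"

text \<open>
  Iterated derivatives of a function on \<open>S\<close>, every derivative being taken relative to \<open>S\<close>
  (hence one-sided at the endpoints of an interval). Values of \<open>f\<close> outside \<open>S\<close> have no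
  influence on the result at points of \<open>S\<close>.
\<close>

primrec deriv_within :: "nat \<Rightarrow> real set \<Rightarrow> (real \<Rightarrow> real) \<Rightarrow> real \<Rightarrow> real" where
  "deriv_within 0 S f = f"
| "deriv_within (Suc n) S f =
     (\<lambda>x. vector_derivative (deriv_within n S f) (at x within S))"

text \<open>
  Existence of the iterated derivative at a point: the previous derivative exists at
  all points of \<open>S\<close> near \<open>x\<close> (including \<open>x\<close>) and is differentiable at \<open>x\<close> relative to \<open>S\<close>.
  This is needed because \<^const>\<open>vector_derivative\<close> returns an arbitrary
  value where no derivative exists.
\<close>

primrec deriv_within_exists :: "nat \<Rightarrow> real set \<Rightarrow> (real \<Rightarrow> real) \<Rightarrow> real \<Rightarrow> bool" where
  "deriv_within_exists 0 S f x \<longleftrightarrow> True"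
| "deriv_within_exists (Suc n) S f x \<longleftrightarrow>
     (\<forall>\<^sub>F y in nhds x. y \<in> S \<longrightarrow> deriv_within_exists n S f y) \<and>
     deriv_within n S f differentiable (at x within S)"

end

theory Submission
  imports Defs
begin

text \<open>
  Fix \<open>l\<close> and let \<open>f\<close> be the indicator function of \<open>{h l..}\<close>. The \<open>l\<close>-th summand of \<open>\<Psi>(x)\<close> is
  \<open>\<nu>(l) E f(Bin(l, x))\<close>, a Bernstein polynomial in \<open>x\<close>. Bernstein polynomials behave
  like powers under differentiation: the \<open>k\<close>-th derivative of \<open>E f(Bin(l, x))\<close> is
  \<open>l (l-1) \<dots> (l-k+1) E (\<Delta>\<^sup>k f)(Bin(l-k, x))\<close>, where \<open>\<Delta>f(j) = f(j+1) - f(j)\<close>. This formula, which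
  iterates \<open>has_derivative_binomial_mean\<close>, carries both parts of the proof.

  For the existence of derivatives, observe that \<open>f\<close> takes values in \<open>{0, 1}\<close>, hence
  \<open>\<bar>\<Delta>\<^sup>k f\<bar> \<le> 2\<^sup>k\<close>, and so the \<open>k\<close>-th derivative of the \<open>l\<close>-th summand is at most \<open>2\<^sup>k \<nu>(l) l\<^sup>k\<close> in
  absolute value, uniformly in \<open>x \<in> [0,1]\<close>. A finite \<open>m\<close>-th moment makes these bounds summable for
  all \<open>k \<le> m\<close>; by the Weierstrass M-test the series for \<open>\<Psi>\<close> may then be differentiated \<open>m\<close> times
  term by term on the whole of \<open>[0,1]\<close>, endpoints included
  (\<open>has_derivative_automaton_map_deriv\<close>).

  For the value at \<open>0\<close>, observe that \<open>Bin(l-m, 0)\<close> is concentrated at \<open>0\<close>, so the \<open>m\<close>-th derivative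
  of the \<open>l\<close>-th summand is a multiple of \<open>(\<Delta>\<^sup>m f)(0)\<close>, which involves only \<open>f(0), \<dots>, f(m)\<close>. If
  \<open>h l > m\<close>, these are all zero (\<open>automaton_term_at_0\<close>). So only the \<open>l\<close> with \<open>h l \<le> m\<close>
  contribute to \<open>\<Psi>\<^sup>(\<^sup>m\<^sup>)(0)\<close>, and there the two child distributions agree.
\<close>

text \<open>
  This is \<open>E f(Bin(n, x))\<close>, expressed by conditioning on the first of the \<open>n\<close> trials. Being a
  polynomial in \<open>x\<close>, it is meaningful for all real \<open>x\<close>, and the recursion makes its properties
  accessible to induction on \<open>n\<close>.
\<close>

primrec binomial_mean :: "nat \<Rightarrow> (nat \<Rightarrow> real) \<Rightarrow> real \<Rightarrow> real" where
  "binomial_mean 0 f x = f 0"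
| "binomial_mean (Suc n) f x =
     (1 - x) * binomial_mean n f x + x * binomial_mean n (\<lambda>k. f (Suc k)) x"

lemma binomial_mean_indicator:
  assumes "x \<in> {0..1}"
  shows "measure_pmf.prob (binomial_pmf n x) A = binomial_mean n (indicator A) x"
proof (induction n arbitrary: A)
  case 0
  show ?case using assms by (simp add: indicator_def binomial_pmf_0)
next
  case (Suc n)
  have "measure_pmf.prob (binomial_pmf (Suc n) x) A =
      (1 - x) * measure_pmf.prob (binomial_pmf n x) A
      + x * measure_pmf.prob (binomial_pmf n x) (Suc -` A)"
  proof -
    have "emeasure (binomial_pmf (Suc n) x) A =
        emeasure (binomial_pmf n x) (Suc -` A) * ennreal x
        + emeasure (binomial_pmf n x) A * ennreal (1 - x)"
      using assms by (simp add: binomial_pmf_Suc map_pmf_def[symmetric] vimage_def)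
    then show ?thesis
      using assms
      by (simp add: measure_pmf.emeasure_eq_measure mult.commute
          flip: ennreal_mult ennreal_plus)
  qed
  moreover have "(\<lambda>k. indicator A (Suc k)) = (indicator (Suc -` A) :: nat \<Rightarrow> real)"
    by (auto simp: indicator_def fun_eq_iff)
  ultimately show ?case by (simp add: Suc.IH)
qed

lemma binomial_mean_diff:
  "binomial_mean n (\<lambda>k. f k - g k) x = binomial_mean n f x - binomial_mean n g x"
proof (induction n arbitrary: f g)
  case 0
  show ?case by simp
next
  case (Suc n)
  show ?case unfolding binomial_mean.simps Suc.IH by (simp add: algebra_simps)
qed

lemma binomial_mean_at_0: "binomial_mean n f 0 = f 0"
  by (induction n) simp_all

text \<open>
  For \<open>x \<in> [0,1]\<close> each recursion step takes a convex combination, so bounds on \<open>f\<close> persist.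
\<close>

lemma abs_binomial_mean_le:
  assumes "x \<in> {0..1}" and "\<And>k. \<bar>f k\<bar> \<le> c"
  shows "\<bar>binomial_mean n f x\<bar> \<le> c"
  using assms(2)
proof (induction n arbitrary: f)
  case 0
  then show ?case by simp
next
  case (Suc n)
  let ?u = "binomial_mean n f x" and ?v = "binomial_mean n (\<lambda>k. f (Suc k)) x"
  have "\<bar>(1 - x) * ?u + x * ?v\<bar> \<le> (1 - x) * \<bar>?u\<bar> + x * \<bar>?v\<bar>"
    using assms(1) by (simp add: order_trans[OF abs_triangle_ineq] abs_mult)
  also have "\<dots> \<le> (1 - x) * c + x * c"
    using assms(1) Suc by (intro add_mono mult_left_mono) auto
  finally show ?case by (simp add: algebra_simps)
qed

definition forward_diff :: "(nat \<Rightarrow> real) \<Rightarrow> nat \<Rightarrow> real" where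
  "forward_diff f = (\<lambda>k. f (Suc k) - f k)"

text \<open>
  In the induction step the product rule yields the difference of the two branches of the recursion,
  which by linearity is the mean of \<open>\<Delta>f\<close> over \<open>Bin(n, x)\<close>, plus the combination of the derivatives
  of the two branches, which by the recursion for \<open>Bin(n, x)\<close> is \<open>n\<close> times the same mean.
\<close>

lemma has_derivative_binomial_mean:
  "(binomial_mean n f has_real_derivative
      real n * binomial_mean (n - 1) (forward_diff f) x) (at x within S)"
proof (induction n arbitrary: f)
  case 0
  show ?case by simp
next
  case (Suc n)
  have eq: "binomial_mean n (forward_diff f) x =
      binomial_mean n (\<lambda>k. f (Suc k)) x - binomial_mean n f x"
    unfolding forward_diff_def by (rule binomial_mean_diff)
  have shift: "(\<lambda>k. forward_diff f (Suc k)) = forward_diff (\<lambda>k. f (Suc k))"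
    by (simp add: forward_diff_def)
  \<comment> \<open>The factor \<open>n\<close> absorbs the case \<open>n = 0\<close>, where \<open>n - 1\<close> is not the predecessor of \<open>n\<close>.\<close>
  have step: "real n * binomial_mean n (forward_diff f) x =
      real n * ((1 - x) * binomial_mean (n - 1) (forward_diff f) x
        + x * binomial_mean (n - 1) (forward_diff (\<lambda>k. f (Suc k))) x)"
    by (cases n) (simp_all add: shift)
  have "((\<lambda>x. (1 - x) * binomial_mean n f x + x * binomial_mean n (\<lambda>k. f (Suc k)) x)
      has_real_derivative real (Suc n) * binomial_mean n (forward_diff f) x) (at x within S)"
    by (rule derivative_eq_intros Suc.IH refl)+ (use eq step in \<open>simp add: algebra_simps\<close>)
  then show ?case by (simp del: of_nat_Suc)
qed

text \<open>
  The falling factorial \<open>n (n-1) \<dots> (n-k+1)\<close>. The truncated subtraction does no harm: for \<open>k > n\<close>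
  the factor with \<open>i = n\<close> is zero.
\<close>

definition falling :: "nat \<Rightarrow> nat \<Rightarrow> real" where
  "falling n k = (\<Prod>i<k. real (n - i))"

text \<open>
  The closed form of the \<open>k\<close>-th derivative of \<open>E f(Bin(n, x))\<close> with respect to \<open>x\<close>.
\<close>

definition binomial_mean_deriv :: "nat \<Rightarrow> nat \<Rightarrow> (nat \<Rightarrow> real) \<Rightarrow> real \<Rightarrow> real" where
  "binomial_mean_deriv k n f x =
     falling n k * binomial_mean (n - k) ((forward_diff ^^ k) f) x"

lemma has_derivative_binomial_mean_deriv:
  "(binomial_mean_deriv k n f has_real_derivative binomial_mean_deriv (Suc k) n f x)
     (at x within S)"
  unfolding binomial_mean_deriv_def
  by (rule derivative_eq_intros has_derivative_binomial_mean refl)+ (simp add: falling_def)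

lemma falling_le_power: "\<bar>falling n k\<bar> \<le> real n ^ k"
proof -
  have "(\<Prod>i<k. real (n - i)) \<le> (\<Prod>i<k. real n)"
    by (rule prod_mono) auto
  then show ?thesis by (simp add: falling_def abs_prod)
qed

lemma abs_forward_diff_iter_le:
  assumes "\<And>j. \<bar>f j\<bar> \<le> 1"
  shows "\<bar>(forward_diff ^^ k) f j\<bar> \<le> 2 ^ k"
proof (induction k arbitrary: j)
  case 0
  show ?case using assms by simp
next
  case (Suc k)
  show ?case using Suc.IH[of j] Suc.IH[of "Suc j"] by (simp add: forward_diff_def)
qed

text \<open>
  The value \<open>(\<Delta>\<^sup>k f)(j)\<close> depends only on \<open>f(j), \<dots>, f(j+k)\<close>. This locality is what makes large
  thresholds invisible to low-order derivatives at \<open>0\<close>.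
\<close>

lemma forward_diff_iter_eq_0:
  assumes "\<And>i. i \<le> j + k \<Longrightarrow> f i = 0"
  shows "(forward_diff ^^ k) f j = 0"
  using assms by (induction k arbitrary: j) (simp_all add: forward_diff_def)

lemma abs_binomial_mean_deriv_le:
  assumes "x \<in> {0..1}" and "\<And>j. \<bar>f j\<bar> \<le> 1"
  shows "\<bar>binomial_mean_deriv k n f x\<bar> \<le> 2 ^ k * real n ^ k"
proof -
  have "\<bar>falling n k\<bar> * \<bar>binomial_mean (n - k) ((forward_diff ^^ k) f) x\<bar> \<le> real n ^ k * 2 ^ k"
    by (intro mult_mono falling_le_power abs_binomial_mean_le abs_forward_diff_iter_le assms) auto
  then show ?thesis by (simp add: binomial_mean_deriv_def abs_mult mult.commute)
qed

text \<open>
  A finite \<open>m\<close>-th moment entails finite moments of all lower orders, since \<open>l\<^sup>k \<le> 1 + l\<^sup>m\<close>.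
\<close>

lemma summable_moment:
  assumes "finite_moment m \<nu>" and "k \<le> m"
  shows "summable (\<lambda>l. pmf \<nu> l * real l ^ k)"
proof -
  have sm: "summable (\<lambda>l. pmf \<nu> l * real l ^ j)" if "finite_moment j \<nu>" for j
    using that unfolding finite_moment_def measure_pmf_eq_density
    by (subst (asm) integrable_density) (simp_all add: integrable_count_space_nat_iff abs_mult)
  have "finite_moment 0 \<nu>" by (simp add: finite_moment_def)
  then have "summable (\<lambda>l. pmf \<nu> l * real l ^ 0 + pmf \<nu> l * real l ^ m)"
    using assms(1) by (intro summable_add sm)
  then show ?thesis
  proof (rule summable_comparison_test[rotated], intro exI allI impI)
    fix l :: nat
    have "real l ^ k \<le> 1 + real l ^ m"
    proof (cases l)
      case 0
      then show ?thesis by (simp add: power_0_left)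
    next
      case (Suc n)
      then have "real l ^ k \<le> real l ^ m"
        using assms(2) by (intro power_increasing) auto
      then show ?thesis by simp
    qed
    then have "pmf \<nu> l * real l ^ k \<le> pmf \<nu> l * (1 + real l ^ m)"
      by (intro mult_left_mono) auto
    then show "norm (pmf \<nu> l * real l ^ k) \<le> pmf \<nu> l * real l ^ 0 + pmf \<nu> l * real l ^ m"
      by (simp add: algebra_simps)
  qed
qed

text \<open>
  The automaton distribution map, differentiated \<open>k\<close> times term by term.
\<close>

definition automaton_map_deriv :: "nat \<Rightarrow> nat pmf \<Rightarrow> (nat \<Rightarrow> nat) \<Rightarrow> real \<Rightarrow> real" where
  "automaton_map_deriv k \<nu> h x =
     (\<Sum>l. pmf \<nu> l * binomial_mean_deriv k l (indicator {h l..}) x)"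

lemma automaton_map_deriv_0:
  assumes "x \<in> {0..1}"
  shows "automaton_map_deriv 0 \<nu> h x = automaton_map \<nu> h x"
  by (simp add: automaton_map_deriv_def automaton_map_def binomial_mean_deriv_def falling_def
      binomial_mean_indicator[OF assms] atLeast_def)

lemma abs_automaton_term_le:
  assumes "x \<in> {0..1}"
  shows "norm (pmf \<nu> l * binomial_mean_deriv k l (indicator {h l..}) x)
      \<le> 2 ^ k * (pmf \<nu> l * real l ^ k)"
proof -
  have "pmf \<nu> l * \<bar>binomial_mean_deriv k l (indicator {h l..}) x\<bar> \<le> pmf \<nu> l * (2 ^ k * real l ^ k)"
    by (intro mult_left_mono abs_binomial_mean_deriv_le assms) (auto simp: indicator_def)
  then show ?thesis by (simp add: abs_mult algebra_simps)
qed

text \<open>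
  Term-by-term differentiation is legitimate because the series of the differentiated terms is
  dominated, uniformly on \<open>[0,1]\<close>, by a multiple of the series for the \<open>(k+1)\<close>-st moment.
\<close>

lemma has_derivative_automaton_map_deriv:
  assumes "finite_moment m \<nu>" and "k < m" and "x \<in> {0..1}"
  shows "(automaton_map_deriv k \<nu> h has_real_derivative automaton_map_deriv (Suc k) \<nu> h x)
     (at x within {0..1})"
proof -
  let ?t = "\<lambda>k l x. pmf \<nu> l * binomial_mean_deriv k l (indicator {h l..}) x"
  have bound: "summable (\<lambda>l. 2 ^ j * (pmf \<nu> l * real l ^ j))" if "j \<le> m" for j
    by (rule summable_mult, rule summable_moment[OF assms(1) that])
  have "\<exists>g. \<forall>x\<in>{0..1}. (\<lambda>l. ?t k l x) sums g x \<and>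
      (g has_real_derivative automaton_map_deriv (Suc k) \<nu> h x) (at x within {0..1})"
  proof (rule has_field_derivative_series)
    show "(?t k l has_real_derivative ?t (Suc k) l x) (at x within {0..1})" for l x
      by (intro DERIV_cmult has_derivative_binomial_mean_deriv)
    show "uniform_limit {0..1} (\<lambda>n x. \<Sum>l<n. ?t (Suc k) l x)
        (automaton_map_deriv (Suc k) \<nu> h) sequentially"
      unfolding automaton_map_deriv_def
      by (rule Weierstrass_m_test[OF abs_automaton_term_le bound]) (use assms(2) in auto)
    show "summable (\<lambda>l. ?t k l 0)"
      by (rule summable_comparison_test'[OF bound abs_automaton_term_le]) (use assms(2) in auto)
  qed auto
  then obtain g where g: "\<And>x. x \<in> {0..1} \<Longrightarrow> (\<lambda>l. ?t k l x) sums g x"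
      "\<And>x. x \<in> {0..1} \<Longrightarrow>
        (g has_real_derivative automaton_map_deriv (Suc k) \<nu> h x) (at x within {0..1})"
    by blast
  show ?thesis
    by (rule has_field_derivative_transform_within[OF g(2)[OF assms(3)] zero_less_one assms(3)])
      (use g(1) in \<open>simp add: automaton_map_deriv_def sums_iff\<close>)
qed

text \<open>
  Values supplied by \<^const>\<open>vector_derivative\<close> are unspecified unless a derivative is known to exist
  and to be unique. A chain of functions \<open>F 0, \<dots>, F m\<close> on a nondegenerate interval, each the
  derivative of its predecessor, provides both at every order at once.
\<close>

lemma deriv_within_eqI:
  fixes F :: "nat \<Rightarrow> real \<Rightarrow> real"
  assumes "a < b"
    and F0: "\<And>x. x \<in> {a..b} \<Longrightarrow> F 0 x = f x"
    and F: "\<And>k x. k < m \<Longrightarrow> x \<in> {a..b} \<Longrightarrow>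
      (F k has_real_derivative F (Suc k) x) (at x within {a..b})"
    and "k \<le> m" and "x \<in> {a..b}"
  shows "deriv_within_exists k {a..b} f x \<and> deriv_within k {a..b} f x = F k x"
  using assms(4,5)
proof (induction k arbitrary: x)
  case 0
  then show ?case by (simp add: F0)
next
  case (Suc k)
  have eq: "deriv_within k {a..b} f y = F k y" if "y \<in> {a..b}" for y
    using Suc that by simp
  have "(F k has_real_derivative F (Suc k) x) (at x within {a..b})"
    using F Suc.prems by simp
  then have *: "(deriv_within k {a..b} f has_real_derivative F (Suc k) x) (at x within {a..b})"
    by (rule has_field_derivative_transform_within[OF _ zero_less_one Suc.prems(2)]) (simp add: eq)
  then have "vector_derivative (deriv_within k {a..b} f) (at x within {a..b}) = F (Suc k) x"
    using assms(1) Suc.prems(2)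
    by (intro vector_derivative_within_closed_interval)
      (auto simp: has_real_derivative_iff_has_vector_derivative)
  moreover have "deriv_within k {a..b} f differentiable (at x within {a..b})"
    using * by (auto simp: has_field_derivative_def differentiable_def)
  ultimately show ?case using Suc by simp
qed

lemma automaton_map_smooth:
  assumes "finite_moment m \<nu>" and "x \<in> {0..1}"
  shows "deriv_within_exists m {0..1} (automaton_map \<nu> h) x \<and>
    deriv_within m {0..1} (automaton_map \<nu> h) x = automaton_map_deriv m \<nu> h x"
  using automaton_map_deriv_0 has_derivative_automaton_map_deriv[OF assms(1)] assms(2)
  by (intro deriv_within_eqI[where m = m]) auto

text \<open>
  At \<open>x = 0\<close> the \<open>m\<close>-th derivative is a multiple of \<open>(\<Delta>\<^sup>m f)(0)\<close> with \<open>f\<close> the indicator function of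
  \<open>{h l..}\<close>, and \<open>f\<close> vanishes on \<open>{0..m}\<close>.
\<close>

lemma automaton_term_at_0:
  assumes "m < h l"
  shows "binomial_mean_deriv m l (indicator {h l..}) 0 = 0"
  using assms
  by (simp add: binomial_mean_deriv_def binomial_mean_at_0 forward_diff_iter_eq_0)

theorem corollary1p3:
  fixes \<nu> \<nu>' :: "nat pmf" and h :: "nat \<Rightarrow> nat" and m :: nat
  assumes "1 \<le> m"
    and "\<And>l. 1 \<le> h l"
    and "finite_moment m \<nu>" and "finite_moment m \<nu>'"
    and "\<And>l. h l \<le> m \<Longrightarrow> pmf \<nu> l = pmf \<nu>' l"
  shows "deriv_within_exists m {0..1} (automaton_map \<nu> h) 0 \<and>
         deriv_within_exists m {0..1} (automaton_map \<nu>' h) 0 \<and>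
         deriv_within m {0..1} (automaton_map \<nu> h) 0 =
           deriv_within m {0..1} (automaton_map \<nu>' h) 0"
proof -
  have "pmf \<nu> l * binomial_mean_deriv m l (indicator {h l..}) 0 =
      pmf \<nu>' l * binomial_mean_deriv m l (indicator {h l..}) 0" for l
    using assms(5)[of l] automaton_term_at_0[of m h l] by (cases "h l \<le> m") auto
  then have "automaton_map_deriv m \<nu> h 0 = automaton_map_deriv m \<nu>' h 0"
    by (simp only: automaton_map_deriv_def)
  then show ?thesis
    using automaton_map_smooth[OF assms(3), of 0 h] automaton_map_smooth[OF assms(4), of 0 h]
    by simp
qed

end
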